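(* Let $K\ge1$, $\mathcal{K}=\{1,\dots,K\}$, and let $\mathbf{x}^{(t)}$ (UAV position), $\{l_{ij}^{(t)}\}$ and $\{\lambda_i^{(T)}\}$ be given and fixed. With the constants $\eta_k^{(t)},\eta_{\mathrm B}^{(t)}>0$ defined in the context, consider the power allocation problem in the real variables $R$, $P_{\mathrm B}$, $P_1,\dots,P_K$: $$\begin{aligned}\max\quad & R-\sum_{i\in\mathcal{I}}\lambda_i^{(T)}\sum_{j\in\mathcal{J}_i} l_{ij}^{(t)}\bigl(1-l_{ij}^{(t)}\bigr)\\ \text{s.t.}\quad & R\le W_{\mathrm U}\log_2\bigl(1+\eta_k^{(t)}P_k\bigr),\quad\forall k\in\mathcal{K},\\ & K R\le W_{\mathrm B}\log_2\bigl(1+\eta_{\mathrm B}^{(t)}P_{\mathrm B}\bigr),\\ & P_k\ge0,\ \forall k\in\mathcal{K},\qquad \sum_{k\in\mathcal{K}}P_k\le P_{\mathrm V}^{\mathrm{tot}},\qquad 0\le P_{\mathrm B}\le P_{\mathrm B}^{\mathrm{tot}}.\end{aligned}$$ Let $\eta_{\mathrm V}^{(t)}=1\big/\sum_{k\in\mathcal{K}}\frac{1}{\eta_k^{(t)}}$. Then the optimal power allocation (maximizing the objective, with minimal transmit powers) is the following. If $$\bigl(1+\eta_{\mathrm B}^{(t)}P_{\mathrm B}^{\mathrm{tot}}\bigr)^{\frac{W_{\mathrm B}}{K}}<\bigl(1+\eta_{\mathrm V}^{(t)}P_{\mathrm V}^{\mathrm{tot}}\bigr)^{W_{\mathrm U}},$$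 then $$P_{\mathrm B}^{(t+1)}=P_{\mathrm B}^{\mathrm{tot}},\qquad P_k^{(t+1)}=\Bigl(\bigl(1+\eta_{\mathrm B}^{(t)}P_{\mathrm B}^{\mathrm{tot}}\bigr)^{\frac{W_{\mathrm B}}{K W_{\mathrm U}}}-1\Bigr)\big/\eta_k^{(t)},\quad k\in\mathcal{K};$$ otherwise, $$P_{\mathrm B}^{(t+1)}=\Bigl(\bigl(1+\eta_{\mathrm V}^{(t)}P_{\mathrm V}^{\mathrm{tot}}\bigr)^{\frac{K W_{\mathrm U}}{W_{\mathrm B}}}-1\Bigr)\big/\eta_{\mathrm B}^{(t)},\qquad P_k^{(t+1)}=\eta_{\mathrm V}^{(t)}P_{\mathrm V}^{\mathrm{tot}}/\eta_k^{(t)},\quad k\in\mathcal{K}.$$ That is, this allocation is feasible and (with the largest $R$ it admits) attains the maximum of the problem, and no other allocation attaining the maximum has a smaller BS power $P_{\mathrm B}$ or a smaller total UAV power $\sum_{k\in\mathcal{K}}P_k$.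
   Context: $\mathbf{x}_{\mathrm B}\in\mathbb{R}^3$ is the position of a base station (BS), $\mathbf{x}_k\in\mathbb{R}^3$ ($k\in\mathcal{K}$) are the positions of $K$ ground users, and $\mathbf{x}^{(t)}\in\mathbb{R}^3$ is a given UAV position different from all of these. The constants $\beta_1,\alpha_1,N_0,W_{\mathrm U},W_{\mathrm B},P_{\mathrm B}^{\mathrm{tot}},P_{\mathrm V}^{\mathrm{tot}}$ are positive reals (channel gain at reference distance 1 m, path loss exponent, noise power spectral density, bandwidth of each UAV-user link, bandwidth of the BS-UAV link, maximum BS transmit power, maximum UAV transmit power). Define $$\eta_k^{(t)}=\frac{\beta_1}{N_0W_{\mathrm U}\|\mathbf{x}^{(t)}-\mathbf{x}_k\|^{\alpha_1}},\qquad \eta_{\mathrm B}^{(t)}=\frac{\beta_1}{N_0W_{\mathrm B}\|\mathbf{x}^{(t)}-\mathbf{x}_{\mathrm B}\|^{\alpha_1}}.$$ $P_{\mathrm B}$ is the BS transmit power, $P_k$ the UAV transmit power allocated to user $k$, and $R$ the minimum communication capacity among the users. $\mathcal{I}$ is a finite index set and $\mathcal{J}_i$, $i\in\mathcal{I}$, are finite index sets; $\lambda_i^{(T)}\ge0$ and $l_{ij}^{(t)}\in[0,1]$ are given numbers, so the second term of the objective is a constant. *)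

theory Defs
  imports "HOL-Analysis.Analysis"
begin

definition link_coeff :: "real \<Rightarrow> real \<Rightarrow> real \<Rightarrow> real \<Rightarrow> real ^ 3 \<Rightarrow> real ^ 3 \<Rightarrow> real" where
  "link_coeff \<beta>\<^sub>1 \<alpha>\<^sub>1 N\<^sub>0 W x y = \<beta>\<^sub>1 / (N\<^sub>0 * W * norm (x - y) powr \<alpha>\<^sub>1)"

text \<open>
  A point of the problem is a triple \<open>(R, P\<^sub>B, P)\<close>: the minimum capacity among the users, the power
  of the base station and the powers \<open>P k\<close> for the users \<open>k \<in> {1..K}\<close>. Values of \<open>P\<close> outside
  \<open>{1..K}\<close> play no role.
\<close>

type_synonym alloc_point = "real \<times> real \<times> (nat \<Rightarrow> real)"

definition objective ::
  "'i set \<Rightarrow> ('i \<Rightarrow> 'j set) \<Rightarrow> ('i \<Rightarrow> real) \<Rightarrow> ('i \<Rightarrow> 'j \<Rightarrow> real) \<Rightarrow> alloc_point \<Rightarrow> real" where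
  "objective I J lam l = (\<lambda>(R, P\<^sub>B, P).
     R - (\<Sum>i\<in>I. lam i * (\<Sum>j\<in>J i. l i j * (1 - l i j))))"

definition feasible ::
  "nat \<Rightarrow> real \<Rightarrow> real \<Rightarrow> (nat \<Rightarrow> real) \<Rightarrow> real \<Rightarrow> real \<Rightarrow> real \<Rightarrow> alloc_point \<Rightarrow> bool" where
  "feasible K W\<^sub>U W\<^sub>B \<eta> \<eta>\<^sub>B Pmax\<^sub>B Pmax\<^sub>V = (\<lambda>(R, P\<^sub>B, P).
     (\<forall>k\<in>{1..K}. R \<le> W\<^sub>U * log 2 (1 + \<eta> k * P k)) \<and>
     real K * R \<le> W\<^sub>B * log 2 (1 + \<eta>\<^sub>B * P\<^sub>B) \<and>
     (\<forall>k\<in>{1..K}. 0 \<le> P k) \<and>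
     (\<Sum>k\<in>{1..K}. P k) \<le> Pmax\<^sub>V \<and>
     0 \<le> P\<^sub>B \<and> P\<^sub>B \<le> Pmax\<^sub>B)"

text \<open>
  The allocation \<open>(P\<^sub>B, P)\<close>, completed by the largest \<open>R\<close> it admits, maximizes \<open>f\<close> over \<open>F\<close>, and no
  maximizer of \<open>f\<close> over \<open>F\<close> has a smaller base station power or a smaller total user power.
\<close>

definition optimal_min_power ::
  "nat \<Rightarrow> (alloc_point \<Rightarrow> real) \<Rightarrow> (alloc_point \<Rightarrow> bool) \<Rightarrow> real \<Rightarrow> (nat \<Rightarrow> real) \<Rightarrow> bool" where
  "optimal_min_power K f F P\<^sub>B P \<longleftrightarrow>
     (\<exists>R. is_arg_max (\<lambda>R. R) (\<lambda>R. F (R, P\<^sub>B, P)) R \<and> is_arg_max f F (R, P\<^sub>B, P)) \<and>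
     (\<forall>R' P\<^sub>B' P'. is_arg_max f F (R', P\<^sub>B', P') \<longrightarrow>
        P\<^sub>B \<le> P\<^sub>B' \<and> (\<Sum>k\<in>{1..K}. P k) \<le> (\<Sum>k\<in>{1..K}. P' k))"

end

theory Submission
  imports Defs
begin

text \<open>
  Reaching a rate \<open>R = W\<^sub>U log\<^sub>2 (1 + s)\<close> forces every user power up to \<open>s / \<eta>\<^sub>k\<close> and the base station
  power up to \<open>((1 + s) powr (K W\<^sub>U / W\<^sub>B) - 1) / \<eta>\<^sub>B\<close>, and these powers suffice. So an allocation with
  a common signal-to-noise ratio \<open>s\<close> is optimal with minimal powers as soon as it exhausts one of
  the two power budgets; the hypothesis of the case distinction tells which budget binds first.
\<close>

lemma capacity_le_iff:
  fixes W s e p :: real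
  assumes "W > 0" "s \<ge> 0" "e > 0" "p \<ge> 0"
  shows "W * log 2 (1 + s) \<le> W * log 2 (1 + e * p) \<longleftrightarrow> s / e \<le> p"
proof -
  have "0 < 1 + e * p" using assms by (simp add: add_pos_nonneg)
  then have "W * log 2 (1 + s) \<le> W * log 2 (1 + e * p) \<longleftrightarrow> s \<le> e * p"
    using assms by simp
  then show ?thesis using assms by (simp add: pos_divide_le_eq mult.commute)
qed

text \<open>The logarithm is strictly increasing on positive arguments, so strictness carries over.
  This form rules out larger rates, while the non-strict one bounds the powers of maximizers from
  below.\<close>

lemma capacity_less_iff:
  fixes W s e p :: real
  assumes "W > 0" "s \<ge> 0" "e > 0" "p \<ge> 0"
  shows "W * log 2 (1 + s) < W * log 2 (1 + e * p) \<longleftrightarrow> s / e < p"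
proof -
  have "0 < 1 + e * p" using assms by (simp add: add_pos_nonneg)
  then have "W * log 2 (1 + s) < W * log 2 (1 + e * p) \<longleftrightarrow> s < e * p"
    using assms by simp
  then show ?thesis using assms by (simp add: pos_divide_less_eq mult.commute)
qed

text \<open>The subtracted double sum does not depend on the point, so only the rate matters for
  maximality.\<close>

lemma is_arg_max_objective_iff:
  "is_arg_max (objective I J lam l) F (R, b, P) \<longleftrightarrow>
     F (R, b, P) \<and> (\<forall>R' b' P'. F (R', b', P') \<longrightarrow> R' \<le> R)"
  by (auto simp: is_arg_max_def objective_def not_less)

text \<open>A rate above \<open>W\<^sub>U * log 2 (1 + s)\<close> would cost strictly more base
  station power and strictly more total user power, which \<open>tight\<close> forbids for one of
  the two. Both cases of the theorem are instances, differing in \<open>s\<close> and in the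
  exhausted budget.\<close>

lemma optimal_min_power_equal_snr:
  fixes \<eta> :: "nat \<Rightarrow> real"
  assumes K: "K \<ge> 1" and W: "W\<^sub>U > 0" "W\<^sub>B > 0"
    and \<eta>: "\<And>k. k \<in> {1..K} \<Longrightarrow> \<eta> k > 0" and \<eta>B: "\<eta>\<^sub>B > 0" and s: "s \<ge> 0"
    and b_eq: "b = ((1 + s) powr (real K * W\<^sub>U / W\<^sub>B) - 1) / \<eta>\<^sub>B"
    and b_le: "b \<le> Pmax\<^sub>B" and sum_le: "(\<Sum>k\<in>{1..K}. s / \<eta> k) \<le> Pmax\<^sub>V"
    and tight: "b = Pmax\<^sub>B \<or> (\<Sum>k\<in>{1..K}. s / \<eta> k) = Pmax\<^sub>V"
  shows "optimal_min_power K (objective I J lam l)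
           (feasible K W\<^sub>U W\<^sub>B \<eta> \<eta>\<^sub>B Pmax\<^sub>B Pmax\<^sub>V) b (\<lambda>k. s / \<eta> k)"
proof -
  let ?F = "feasible K W\<^sub>U W\<^sub>B \<eta> \<eta>\<^sub>B Pmax\<^sub>B Pmax\<^sub>V"
  define R where "R = W\<^sub>U * log 2 (1 + s)"
  \<comment> \<open>The signal-to-noise ratio at which the base station link carries exactly
    \<open>K\<close> times the rate \<open>R\<close>.\<close>
  define t where "t = (1 + s) powr (real K * W\<^sub>U / W\<^sub>B) - 1"
  have b: "b = t / \<eta>\<^sub>B" using b_eq by (simp add: t_def)
  have t: "t \<ge> 0"
    using s W by (simp add: t_def ge_one_powr_ge_zero)
  have KR: "real K * R = W\<^sub>B * log 2 (1 + t)"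
    using s W by (simp add: R_def t_def log_powr)
  have b_nonneg: "b \<ge> 0" using b t \<eta>B by simp
  have feas: "?F (R, b, \<lambda>k. s / \<eta> k)"
  proof -
    have "R \<le> W\<^sub>U * log 2 (1 + \<eta> k * (s / \<eta> k))" "0 \<le> s / \<eta> k" if "k \<in> {1..K}" for k
      using \<eta>[OF that] s by (simp_all add: R_def)
    moreover have "real K * R \<le> W\<^sub>B * log 2 (1 + \<eta>\<^sub>B * b)"
      using KR b \<eta>B by simp
    ultimately show ?thesis
      using b_nonneg b_le sum_le by (simp add: feasible_def)
  qed
  \<comment> \<open>Assuming only \<open>R \<le> R'\<close> is enough for maximizers: the point in
    \<open>feas\<close> competes with each of them.\<close>
  have min_powers: "b \<le> b'" "(\<Sum>k\<in>{1..K}. s / \<eta> k) \<le> (\<Sum>k\<in>{1..K}. P' k)"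
    if F: "?F (R', b', P')" and "R \<le> R'" for R' b' P'
  proof -
    have "real K * R \<le> real K * R'" using \<open>R \<le> R'\<close> by (simp add: mult_left_mono)
    then have "W\<^sub>B * log 2 (1 + t) \<le> W\<^sub>B * log 2 (1 + \<eta>\<^sub>B * b')"
      using F KR by (simp add: feasible_def)
    then show "b \<le> b'"
      using F b capacity_le_iff[OF W(2) t \<eta>B] by (simp add: feasible_def)
    have "s / \<eta> k \<le> P' k" if k: "k \<in> {1..K}" for k
    proof -
      have "0 \<le> P' k" "W\<^sub>U * log 2 (1 + s) \<le> W\<^sub>U * log 2 (1 + \<eta> k * P' k)"
        using F k \<open>R \<le> R'\<close> unfolding feasible_def R_def by fastforce+
      then show ?thesis using capacity_le_iff W s \<eta>[OF k] by blast
    qed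
    then show "(\<Sum>k\<in>{1..K}. s / \<eta> k) \<le> (\<Sum>k\<in>{1..K}. P' k)" by (rule sum_mono)
  qed
  have max: "R' \<le> R" if F: "?F (R', b', P')" for R' b' P'
  proof (rule ccontr)
    assume "\<not> R' \<le> R"
    then have less: "R < R'" by simp
    have "real K * R < real K * R'" using less K by simp
    then have "W\<^sub>B * log 2 (1 + t) < W\<^sub>B * log 2 (1 + \<eta>\<^sub>B * b')"
      using F KR by (simp add: feasible_def)
    then have "b < b'"
      using F b capacity_less_iff[OF W(2) t \<eta>B] by (simp add: feasible_def)
    moreover have "s / \<eta> k < P' k" if k: "k \<in> {1..K}" for k
    proof -
      have "0 \<le> P' k" "W\<^sub>U * log 2 (1 + s) < W\<^sub>U * log 2 (1 + \<eta> k * P' k)"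
        using F k less unfolding feasible_def R_def by fastforce+
      then show ?thesis using capacity_less_iff W s \<eta>[OF k] by blast
    qed
    \<comment> \<open>The sum inherits strictness because \<open>K \<ge> 1\<close> makes the index
      set nonempty.\<close>
    then have "(\<Sum>k\<in>{1..K}. s / \<eta> k) < (\<Sum>k\<in>{1..K}. P' k)"
      using K by (intro sum_strict_mono) auto
    ultimately show False
      using F tight by (simp add: feasible_def)
  qed
  have opt: "is_arg_max (objective I J lam l) ?F (R, b, \<lambda>k. s / \<eta> k)"
    using feas max by (simp add: is_arg_max_objective_iff)
  moreover have "is_arg_max (\<lambda>R. R) (\<lambda>R. ?F (R, b, \<lambda>k. s / \<eta> k)) R"
    using feas max by (auto simp: is_arg_max_def not_less)
  ultimately show ?thesis
    unfolding optimal_min_power_def is_arg_max_objective_iff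
    using feas min_powers by blast
qed

lemma link_coeff_pos:
  assumes "\<beta> > 0" "N > 0" "W > 0" "x \<noteq> y"
  shows "link_coeff \<beta> \<alpha> N W x y > 0"
  using assms by (simp add: link_coeff_def)

theorem theorem2:
  fixes K :: nat
    and x x\<^sub>B :: "real ^ 3" and x\<^sub>U :: "nat \<Rightarrow> real ^ 3"
    and \<beta>\<^sub>1 \<alpha>\<^sub>1 N\<^sub>0 W\<^sub>U W\<^sub>B Pmax\<^sub>B Pmax\<^sub>V :: real
    and I :: "'i set" and J :: "'i \<Rightarrow> 'j set"
    and lam :: "'i \<Rightarrow> real" and l :: "'i \<Rightarrow> 'j \<Rightarrow> real"
    and \<eta> :: "nat \<Rightarrow> real" and \<eta>\<^sub>B \<eta>\<^sub>V :: real
  assumes "K \<ge> 1"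
    and "\<beta>\<^sub>1 > 0" "\<alpha>\<^sub>1 > 0" "N\<^sub>0 > 0" "W\<^sub>U > 0" "W\<^sub>B > 0" "Pmax\<^sub>B > 0" "Pmax\<^sub>V > 0"
    and "x \<noteq> x\<^sub>B" "\<And>k. k \<in> {1..K} \<Longrightarrow> x \<noteq> x\<^sub>U k"
    and "finite I" "\<And>i. i \<in> I \<Longrightarrow> finite (J i)"
    and "\<And>i. i \<in> I \<Longrightarrow> lam i \<ge> 0"
    and "\<And>i j. i \<in> I \<Longrightarrow> j \<in> J i \<Longrightarrow> l i j \<in> {0..1}"
    and "\<And>k. k \<in> {1..K} \<Longrightarrow> \<eta> k = link_coeff \<beta>\<^sub>1 \<alpha>\<^sub>1 N\<^sub>0 W\<^sub>U x (x\<^sub>U k)"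
    and "\<eta>\<^sub>B = link_coeff \<beta>\<^sub>1 \<alpha>\<^sub>1 N\<^sub>0 W\<^sub>B x x\<^sub>B"
    and "\<eta>\<^sub>V = 1 / (\<Sum>k\<in>{1..K}. 1 / \<eta> k)"
  shows
    "((1 + \<eta>\<^sub>B * Pmax\<^sub>B) powr (W\<^sub>B / real K) < (1 + \<eta>\<^sub>V * Pmax\<^sub>V) powr W\<^sub>U \<longrightarrow>
        optimal_min_power K (objective I J lam l) (feasible K W\<^sub>U W\<^sub>B \<eta> \<eta>\<^sub>B Pmax\<^sub>B Pmax\<^sub>V)
          Pmax\<^sub>B
          (\<lambda>k. ((1 + \<eta>\<^sub>B * Pmax\<^sub>B) powr (W\<^sub>B / (real K * W\<^sub>U)) - 1) / \<eta> k)) \<and>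
     (\<not> (1 + \<eta>\<^sub>B * Pmax\<^sub>B) powr (W\<^sub>B / real K) < (1 + \<eta>\<^sub>V * Pmax\<^sub>V) powr W\<^sub>U \<longrightarrow>
        optimal_min_power K (objective I J lam l) (feasible K W\<^sub>U W\<^sub>B \<eta> \<eta>\<^sub>B Pmax\<^sub>B Pmax\<^sub>V)
          (((1 + \<eta>\<^sub>V * Pmax\<^sub>V) powr (real K * W\<^sub>U / W\<^sub>B) - 1) / \<eta>\<^sub>B)
          (\<lambda>k. \<eta>\<^sub>V * Pmax\<^sub>V / \<eta> k))"
proof -
  have \<eta>: "\<eta> k > 0" if "k \<in> {1..K}" for k
    using assms that by (simp add: link_coeff_pos)
  have \<eta>B: "\<eta>\<^sub>B > 0" using assms by (simp add: link_coeff_pos)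
  have "(\<Sum>k\<in>{1..K}. 1 / \<eta> k) > 0"
    using \<eta> \<open>K \<ge> 1\<close> by (intro sum_pos) auto
  \<comment> \<open>Serving all users at a common ratio \<open>s\<close> costs as much as one link
    with coefficient \<open>\<eta>\<^sub>V\<close>, the reciprocal of the sum of the
    \<open>1 / \<eta> k\<close>.\<close>
  then have \<eta>V: "\<eta>\<^sub>V > 0" and sum_snr: "(\<Sum>k\<in>{1..K}. s / \<eta> k) = s / \<eta>\<^sub>V" for s
    using assms(17) by (simp_all add: sum_distrib_left)
  define u where "u = 1 + \<eta>\<^sub>B * Pmax\<^sub>B"
  define v where "v = 1 + \<eta>\<^sub>V * Pmax\<^sub>V"
  have u: "u > 1" and v: "v > 1"
    using \<eta>B \<eta>V assms by (simp_all add: u_def v_def)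
  have "optimal_min_power K (objective I J lam l) (feasible K W\<^sub>U W\<^sub>B \<eta> \<eta>\<^sub>B Pmax\<^sub>B Pmax\<^sub>V)
          Pmax\<^sub>B (\<lambda>k. (u powr (W\<^sub>B / (real K * W\<^sub>U)) - 1) / \<eta> k)"
    if BS_binds: "u powr (W\<^sub>B / real K) < v powr W\<^sub>U"
  proof (rule optimal_min_power_equal_snr)
    \<comment> \<open>Here \<open>1 + s\<close> is
      \<open>u powr (W\<^sub>B / (real K * W\<^sub>U))\<close>. The root of order
      \<open>W\<^sub>U\<close> turns the case hypothesis into \<open>1 + s \<le> v\<close>, which is
      the UAV power budget.\<close>
    have "(u powr (W\<^sub>B / real K)) powr (1 / W\<^sub>U) \<le> (v powr W\<^sub>U) powr (1 / W\<^sub>U)"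
      using BS_binds assms by (intro powr_mono2) auto
    then have "u powr (W\<^sub>B / (real K * W\<^sub>U)) \<le> v"
      using v assms by (simp add: powr_powr)
    then show "(\<Sum>k\<in>{1..K}. (u powr (W\<^sub>B / (real K * W\<^sub>U)) - 1) / \<eta> k) \<le> Pmax\<^sub>V"
      unfolding sum_snr using \<eta>V by (simp add: v_def pos_divide_le_eq mult.commute)
    \<comment> \<open>The two exponents are reciprocal, so the nested powers collapse to
      \<open>u\<close>. The base station budget is thus the tight one.\<close>
    show "Pmax\<^sub>B = ((1 + (u powr (W\<^sub>B / (real K * W\<^sub>U)) - 1)) powr (real K * W\<^sub>U / W\<^sub>B) - 1) / \<eta>\<^sub>B"
      using u \<eta>B assms by (simp add: powr_powr) (simp add: u_def)
  qed (use assms \<eta> \<eta>B u in \<open>auto simp: ge_one_powr_ge_zero\<close>)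
  moreover have "optimal_min_power K (objective I J lam l)
          (feasible K W\<^sub>U W\<^sub>B \<eta> \<eta>\<^sub>B Pmax\<^sub>B Pmax\<^sub>V)
          ((v powr (real K * W\<^sub>U / W\<^sub>B) - 1) / \<eta>\<^sub>B) (\<lambda>k. \<eta>\<^sub>V * Pmax\<^sub>V / \<eta> k)"
    if UAV_binds: "\<not> u powr (W\<^sub>B / real K) < v powr W\<^sub>U"
  proof (rule optimal_min_power_equal_snr)
    \<comment> \<open>Now \<open>1 + s = v\<close>. The exponent \<open>real K / W\<^sub>B\<close>
      isolates \<open>u\<close> on the right, giving the base station budget.\<close>
    have "(v powr W\<^sub>U) powr (real K / W\<^sub>B) \<le> (u powr (W\<^sub>B / real K)) powr (real K / W\<^sub>B)"
      using UAV_binds assms by (intro powr_mono2) auto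
    then have "v powr (real K * W\<^sub>U / W\<^sub>B) \<le> u"
      using u assms by (simp add: powr_powr mult.commute)
    then show "(v powr (real K * W\<^sub>U / W\<^sub>B) - 1) / \<eta>\<^sub>B \<le> Pmax\<^sub>B"
      using \<eta>B by (simp add: u_def pos_divide_le_eq mult.commute)
    \<comment> \<open>With \<open>s = \<eta>\<^sub>V * Pmax\<^sub>V\<close> the UAV budget is spent
      exactly, which settles \<open>tight\<close>.\<close>
    have "(\<Sum>k\<in>{1..K}. \<eta>\<^sub>V * Pmax\<^sub>V / \<eta> k) = Pmax\<^sub>V"
      unfolding sum_snr using \<eta>V by simp
    then show "(\<Sum>k\<in>{1..K}. \<eta>\<^sub>V * Pmax\<^sub>V / \<eta> k) \<le> Pmax\<^sub>V"
      and "(v powr (real K * W\<^sub>U / W\<^sub>B) - 1) / \<eta>\<^sub>B = Pmax\<^sub>B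
        \<or> (\<Sum>k\<in>{1..K}. \<eta>\<^sub>V * Pmax\<^sub>V / \<eta> k) = Pmax\<^sub>V"
      by simp_all
  qed (use assms(1,5-8) \<eta> \<eta>B \<eta>V in \<open>auto simp: v_def\<close>)
  ultimately show ?thesis unfolding u_def v_def by blast
qed

end
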